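(* Let $k,q\in\mathbb{N}$ be positive integers and let $\mathfrak{f}_{11}:[-\pi,\pi]\to\mathbb{C}^{k\times k}$, $\mathfrak{f}_{12}:[-\pi,\pi]\to\mathbb{C}^{k\times q}$, $\mathfrak{f}_{21}:[-\pi,\pi]\to\mathbb{C}^{q\times k}$, $\mathfrak{f}_{22}:[-\pi,\pi]\to\mathbb{C}^{q\times q}$ be matrix-valued functions with entries in $L^1([-\pi,\pi])$. For $n\in\mathbb{N}$ let $$A_n=\begin{bmatrix}T_n(\mathfrak{f}_{11}) & T_n(\mathfrak{f}_{12})\\ T_n(\mathfrak{f}_{21}) & T_n(\mathfrak{f}_{22})\end{bmatrix},\qquad \mathfrak{f}=\begin{bmatrix}\mathfrak{f}_{11} & \mathfrak{f}_{12}\\ \mathfrak{f}_{21} & \mathfrak{f}_{22}\end{bmatrix}:[-\pi,\pi]\to\mathbb{C}^{(k+q)\times(k+q)}.$$ Then, for each $n$, there exists a permutation matrix $\Pi$ (of size $(k+q)n$) such that $A_n=\Pi\,T_n(\mathfrak{f})\,\Pi^T$. Hence $A_n$ and $T_n(\mathfrak{f})$ share the same eigenvalues and the same singular values, and consequently $\{A_n\}_n$ and $\{T_n(\mathfrak{f})\}_n$ enjoy the same distribution features; that is, for every measurable matrix-valued function $\varphi:[\alpha,\beta]\to\mathbb{C}^{r\times r}$, $\{A_n\}_n\sim_\lambda(\varphi,[\alpha,\beta])$ if and only if $\{T_n(\mathfrak{f})\}_n\sim_\lambda(\varphi,[\alpha,\beta])$, and $\{A_n\}_n\sim_\sigma(\varphi,[\alpha,\beta])$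 if and only if $\{T_n(\mathfrak{f})\}_n\sim_\sigma(\varphi,[\alpha,\beta])$.
   Context: Block Toeplitz matrices: for positive integers $a,b$ (possibly $a\neq b$) and a function $\varphi:[-\pi,\pi]\to\mathbb{C}^{a\times b}$ with entries in $L^1([-\pi,\pi])$, the Fourier coefficients are $t_j:=\frac{1}{2\pi}\int_{-\pi}^{\pi}\varphi(\theta)e^{-\mathbf{i}j\theta}\,\mathrm{d}\theta\in\mathbb{C}^{a\times b}$ (component-wise integrals, $j\in\mathbb{Z}$), and for $n\in\mathbb{N}$ the matrix $T_n(\varphi):=[t_{i-k}]_{i,k=1}^{n}$ is the $an\times bn$ block Toeplitz matrix generated by $\varphi$. Distributions: let $\varphi:[\alpha,\beta]\to\mathbb{C}^{r\times r}$ be a measurable matrix-valued function with eigenvalues $\lambda_i(\varphi)$ and singular values $\sigma_i(\varphi)$, $i=1,\dots,r$, and let $\{A_n\}_n$ be a sequence of square matrices with $A_n$ of size $d_n$, $d_n\to\infty$ as $n\to\infty$, with eigenvalues $\lambda_j(A_n)$ and singular values $\sigma_j(A_n)$, $j=1,\dots,d_n$. One writes $\{A_n\}_n\sim_\lambda(\varphi,[\alpha,\beta])$ if $$\lim_{n\to\infty}\frac{1}{d_n}\sum_{j=1}^{d_n}F(\lambda_j(A_n))=\frac{1}{\beta-\alpha}\int_\alpha^\beta\frac{\sum_{i=1}^{r}F(\lambda_i(\varphi(t)))}{r}\,\mathrm{d}t$$ for every continuous function $F$ with compact support, and $\{A_n\}_n\sim_\sigma(\varphi,[\alpha,\beta])$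 if the same relation holds, for every continuous function $F$ with compact support, with $\lambda_j(A_n)$ and $\lambda_i(\varphi(t))$ replaced by $\sigma_j(A_n)$ and $\sigma_i(\varphi(t))$. *)

theory Defs
  imports
    "HOL-Analysis.Analysis"
    "HOL-Computational_Algebra.Computational_Algebra"
    "HOL-Combinatorics.Permutations"
    "Jordan_Normal_Form.Spectral_Radius"
begin

text \<open>
  A matrix-valued function on an interval is a function of type \<open>real \<Rightarrow> complex mat\<close>; its values
  outside the interval are irrelevant. \<open>L\<^sup>1\<close> and measurability are meant with respect to Lebesgue
  (not merely Borel) measurable functions.
\<close>

definition L1_matrix_fun :: "nat \<Rightarrow> nat \<Rightarrow> (real \<Rightarrow> complex mat) \<Rightarrow> bool" where
  "L1_matrix_fun a b \<phi> \<longleftrightarrow>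
     (\<forall>\<theta>\<in>{-pi..pi}. \<phi> \<theta> \<in> carrier_mat a b) \<and>
     (\<forall>r<a. \<forall>s<b. (\<lambda>\<theta>. \<phi> \<theta> $$ (r, s)) absolutely_integrable_on {-pi..pi})"

definition measurable_matrix_fun ::
    "nat \<Rightarrow> real \<Rightarrow> real \<Rightarrow> (real \<Rightarrow> complex mat) \<Rightarrow> bool" where
  "measurable_matrix_fun r \<alpha> \<beta> \<phi> \<longleftrightarrow>
     (\<forall>t\<in>{\<alpha>..\<beta>}. \<phi> t \<in> carrier_mat r r) \<and>
     (\<forall>i<r. \<forall>j<r. (\<lambda>t. \<phi> t $$ (i, j)) \<in> borel_measurable (lebesgue_on {\<alpha>..\<beta>}))"

definition fourier_coeff :: "nat \<Rightarrow> nat \<Rightarrow> (real \<Rightarrow> complex mat) \<Rightarrow> int \<Rightarrow> complex mat" where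
  "fourier_coeff a b \<phi> j =
     Matrix.mat a b (\<lambda>(r, s). 1 / (2 * of_real pi) *
       (LINT \<theta>:{-pi..pi}|lebesgue. \<phi> \<theta> $$ (r, s) * exp (- (\<i> * of_int j * of_real \<theta>))))"

text \<open>
  The \<open>(i, l)\<close> entry of the block Toeplitz matrix, counting from 0, lies in the block with block
  indices \<open>(i div a, l div b)\<close>, at position \<open>(i mod a, l mod b)\<close> of that block.
\<close>

definition block_toeplitz :: "nat \<Rightarrow> nat \<Rightarrow> nat \<Rightarrow> (real \<Rightarrow> complex mat) \<Rightarrow> complex mat" where
  "block_toeplitz a b n \<phi> =
     Matrix.mat (a * n) (b * n) (\<lambda>(i, l).
       fourier_coeff a b \<phi> (int (i div a) - int (l div b)) $$ (i mod a, l mod b))"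

definition permutation_matrix :: "nat \<Rightarrow> complex mat \<Rightarrow> bool" where
  "permutation_matrix N P \<longleftrightarrow>
     (\<exists>p. p permutes {..<N} \<and> P = Matrix.mat N N (\<lambda>(i, j). if j = p i then 1 else 0))"

text \<open>Eigenvalues and singular values are multisets, counted with (algebraic) multiplicity.\<close>

definition eigenvalues :: "complex mat \<Rightarrow> complex multiset" where
  "eigenvalues A = proots (char_poly A)"

lemma size_eigenvalues:
  assumes "A \<in> carrier_mat n n"
  shows "size (eigenvalues A) = n"
  using degree_monic_char_poly[OF assms] by (simp add: eigenvalues_def size_proots_complex)

lemma set_eigenvalues:
  assumes "A \<in> carrier_mat n n"
  shows "set_mset (eigenvalues A) = Collect (eigenvalue A)"
proof -
  have "char_poly A \<noteq> 0"
    using degree_monic_char_poly[OF assms] by auto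
  then show ?thesis
    using eigenvalue_root_char_poly[OF assms] by (auto simp: eigenvalues_def)
qed

text \<open>
  The eigenvalues of the positive semidefinite matrix \<open>mat_adjoint A * A\<close> are real and nonnegative,
  so taking real parts loses nothing.
\<close>

definition singular_values :: "complex mat \<Rightarrow> real multiset" where
  "singular_values A = image_mset (\<lambda>z. sqrt (Re z)) (eigenvalues (mat_adjoint A * A))"

definition compactly_supported_continuous :: "('a::topological_space \<Rightarrow> complex) \<Rightarrow> bool" where
  "compactly_supported_continuous F \<longleftrightarrow>
     continuous_on UNIV F \<and> compact (closure {x. F x \<noteq> 0})"

text \<open>
  Both distributions are instances of one scheme: \<open>S\<close> maps a matrix to the multiset of its
  eigenvalues or of its singular values, and the test functions \<open>F\<close> live on the complex plane or on
  the real line accordingly. The number \<open>d\<^sub>n\<close> is \<open>dim_row (A n)\<close>.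
\<close>

definition distributed ::
    "(complex mat \<Rightarrow> 'a::topological_space multiset) \<Rightarrow> (nat \<Rightarrow> complex mat) \<Rightarrow>
     nat \<Rightarrow> (real \<Rightarrow> complex mat) \<Rightarrow> real \<Rightarrow> real \<Rightarrow> bool" where
  "distributed S A r \<phi> \<alpha> \<beta> \<longleftrightarrow>
     (\<forall>n. square_mat (A n)) \<and>
     filterlim (\<lambda>n. dim_row (A n)) at_top sequentially \<and>
     (\<forall>F. compactly_supported_continuous F \<longrightarrow>
       (\<lambda>n. (\<Sum>x\<in>#S (A n). F x) / of_nat (dim_row (A n)))
         \<longlonglongrightarrow> 1 / of_real (\<beta> - \<alpha>) *
              (LINT t:{\<alpha>..\<beta>}|lebesgue. (\<Sum>x\<in>#S (\<phi> t). F x) / of_nat r))"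

definition eigenvalue_distributed ::
    "(nat \<Rightarrow> complex mat) \<Rightarrow> nat \<Rightarrow> (real \<Rightarrow> complex mat) \<Rightarrow> real \<Rightarrow> real \<Rightarrow> bool" where
  "eigenvalue_distributed = distributed eigenvalues"

definition singular_value_distributed ::
    "(nat \<Rightarrow> complex mat) \<Rightarrow> nat \<Rightarrow> (real \<Rightarrow> complex mat) \<Rightarrow> real \<Rightarrow> real \<Rightarrow> bool" where
  "singular_value_distributed = distributed singular_values"

end

theory Submission
  imports Defs
begin

text \<open>
  Both matrices consist of the same Fourier coefficients and differ only in the order in which rows
  and columns are listed. An index of either matrix names a block position \<open>x < n\<close> and a component of
  \<open>\<complex>\<^sup>k \<times> \<complex>\<^sup>q\<close>. The matrix \<open>T\<^sub>n(f)\<close> lists these pairs with the position varying slowest, so that for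
  each position the \<open>k\<close> components of the first kind are followed by the \<open>q\<close> components of the second.
  The matrix \<open>A\<^sub>n\<close> lists all pairs with a component of the first kind before all pairs with a
  component of the second kind. Since Fourier coefficients are taken entrywise, forming them commutes
  with assembling a matrix from four blocks (\<open>fourier_coeff_four_block_mat\<close>), and therefore the
  permutation \<open>p\<close> that translates one enumeration into the other (\<open>regroup_indices\<close>) satisfies
  \<open>A\<^sub>n(i, l) = T\<^sub>n(f)(p i, p l)\<close> (\<open>block_toeplitz_four_block_index\<close>).

  Everything else holds for any two matrices related by such a simultaneous renumbering of rows and
  columns. The renumbering is conjugation by the permutation matrix of \<open>p\<close>
  (\<open>reindexed_eq_conjugate\<close>), whose inverse is its transpose, so the characteristic polynomials agree.
  It also passes to the matrices \<open>A\<^sup>*A\<close>, because the summation index of the product can be renumbered by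
  \<open>p\<close> as well; hence the singular values agree. Being equal for each single \<open>n\<close>, the spectra have
  the same averages and so the same limits of averages.
\<close>

section \<open>Simultaneous permutation of rows and columns\<close>

definition reindex_matrix :: "nat \<Rightarrow> (nat \<Rightarrow> nat) \<Rightarrow> complex mat" where
  "reindex_matrix N p = Matrix.mat N N (\<lambda>(i, j). if j = p i then 1 else 0)"

lemma reindex_matrix_carrier [simp]: "reindex_matrix N p \<in> carrier_mat N N"
  by (simp add: reindex_matrix_def)

lemma conjugate_by_reindex_matrix_index:
  assumes p: "p permutes {..<N}" and B: "B \<in> carrier_mat N N" and "i < N" "l < N"
  shows "(reindex_matrix N p * B * transpose_mat (reindex_matrix N p)) $$ (i, l) = B $$ (p i, p l)"
proof -
  have lt: "p i < N" "p l < N"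
    using permutes_in_image[OF p] assms by auto
  have "(reindex_matrix N p * B) $$ (i, m) = B $$ (p i, m)" if "m < N" for m
    using that assms lt by (simp add: reindex_matrix_def scalar_prod_def if_distrib
        if_distribR sum.delta cong: if_cong)
  then show ?thesis
    using assms lt by (simp add: reindex_matrix_def scalar_prod_def if_distrib 
        sum.delta cong: if_cong)
qed

text \<open>
  The entrywise relation is what can be checked for block Toeplitz matrices and what is inherited by
  \<open>mat_adjoint A * A\<close>; the product form is what gives similarity.
\<close>

lemma reindexed_eq_conjugate:
  assumes p: "p permutes {..<N}"
    and A: "A \<in> carrier_mat N N" and B: "B \<in> carrier_mat N N"
    and AB: "\<And>i l. i < N \<Longrightarrow> l < N \<Longrightarrow> A $$ (i, l) = B $$ (p i, p l)"
  shows "A = reindex_matrix N p * B * transpose_mat (reindex_matrix N p)"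
proof (rule eq_matI)
  fix i l
  assume "i < dim_row (reindex_matrix N p * B * transpose_mat (reindex_matrix N p))"
    and "l < dim_col (reindex_matrix N p * B * transpose_mat (reindex_matrix N p))"
  then have "i < N" "l < N"
    by (simp_all add: reindex_matrix_def)
  then show "A $$ (i, l) = (reindex_matrix N p * B * transpose_mat (reindex_matrix N p)) $$ (i, l)"
    using AB conjugate_by_reindex_matrix_index[OF p B] by simp
qed (use A in \<open>simp_all add: reindex_matrix_def\<close>)

lemma eigenvalues_reindexed:
  assumes p: "p permutes {..<N}"
    and A: "A \<in> carrier_mat N N" and B: "B \<in> carrier_mat N N"
    and AB: "\<And>i l. i < N \<Longrightarrow> l < N \<Longrightarrow> A $$ (i, l) = B $$ (p i, p l)"
  shows "eigenvalues A = eigenvalues B"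
proof -
  let ?P = "reindex_matrix N p"
  \<comment> \<open>The identity matrix is its own renumbering because \<open>p\<close> is injective, so conjugating it by the
    permutation matrix gives orthogonality.\<close>
  have orth: "?P * transpose_mat ?P = 1\<^sub>m N"
  proof -
    have "(1\<^sub>m N :: complex mat) = ?P * 1\<^sub>m N * transpose_mat ?P"
    proof (rule reindexed_eq_conjugate[OF p])
      fix i l assume "i < N" "l < N"
      then show "(1\<^sub>m N :: complex mat) $$ (i, l) = 1\<^sub>m N $$ (p i, p l)"
        using permutes_in_image[OF p] permutes_inj[OF p] by (auto dest: injD)
    qed auto
    then show ?thesis
      by (simp add: right_mult_one_mat[OF reindex_matrix_carrier])
  qed
  then have "transpose_mat ?P * ?P = 1\<^sub>m N"
    by (intro mat_mult_left_right_inverse[of ?P N]) auto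
  then have "similar_mat_wit A B ?P (transpose_mat ?P)"
    using orth A B reindexed_eq_conjugate[OF p A B AB]
    by (intro similar_mat_witI[of _ _ N]) auto
  then have "similar_mat A B"
    unfolding similar_mat_def by blast
  then show ?thesis
    using char_poly_similar by (metis eigenvalues_def)
qed

lemma mat_adjoint_mult_self_index:
  assumes "B \<in> carrier_mat N N" "i < N" "l < N"
  shows "(mat_adjoint B * B) $$ (i, l) = (\<Sum>m<N. cnj (B $$ (m, i)) * B $$ (m, l))"
  using assms by (simp add: mat_adjoint_def mat_of_rows_def scalar_prod_def lessThan_atLeast0)

text \<open>
  Renumbering the columns of \<open>B\<close> renumbers rows and columns of \<open>mat_adjoint B * B\<close>; renumbering the rows
  of \<open>B\<close> only permutes the terms of each inner product. So the Gram matrices are again related by \<open>p\<close>.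
\<close>

lemma singular_values_reindexed:
  assumes p: "p permutes {..<N}"
    and A: "A \<in> carrier_mat N N" and B: "B \<in> carrier_mat N N"
    and AB: "\<And>i l. i < N \<Longrightarrow> l < N \<Longrightarrow> A $$ (i, l) = B $$ (p i, p l)"
  shows "singular_values A = singular_values B"
proof -
  have "eigenvalues (mat_adjoint A * A) = eigenvalues (mat_adjoint B * B)"
  proof (rule eigenvalues_reindexed[OF p])
    fix i l assume il: "i < N" "l < N"
    then have pil: "p i < N" "p l < N"
      using permutes_in_image[OF p] by auto
    have "(mat_adjoint A * A) $$ (i, l) = (\<Sum>m<N. cnj (B $$ (p m, p i)) * B $$ (p m, p l))"
      using il by (simp add: mat_adjoint_mult_self_index[OF A] AB)
    also have "\<dots> = (\<Sum>m<N. cnj (B $$ (m, p i)) * B $$ (m, p l))"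
      using sum.permute[OF p, of "\<lambda>m. cnj (B $$ (m, p i)) * B $$ (m, p l)"] by (simp add: o_def)
    also have "\<dots> = (mat_adjoint B * B) $$ (p i, p l)"
      using mat_adjoint_mult_self_index[OF B pil] by simp
    finally show "(mat_adjoint A * A) $$ (i, l) = (mat_adjoint B * B) $$ (p i, p l)" .
  qed (use A B in \<open>auto simp: mat_adjoint_def mat_of_rows_def\<close>)
  then show ?thesis
    by (simp add: singular_values_def)
qed

section \<open>The index permutation\<close>

text \<open>
  An index \<open>i\<close> of the block matrix with Toeplitz blocks is sent to the index of the same row in the
  block Toeplitz matrix with blocks of size \<open>k + q\<close>. Outside the index range it is the identity, so
  that it is a permutation in the sense of \<open>permutes\<close>.
\<close>

definition regroup_indices :: "nat \<Rightarrow> nat \<Rightarrow> nat \<Rightarrow> nat \<Rightarrow> nat" where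
  "regroup_indices k q n i =
     (if i < k * n then i div k * (k + q) + i mod k
      else if i < (k + q) * n then (i - k * n) div q * (k + q) + (k + (i - k * n) mod q)
      else i)"

lemma add_mult_less_mult:
  fixes a b n r :: nat
  assumes "r < b" "a < n"
  shows "a * b + r < b * n"
proof -
  have "a * b + r < Suc a * b" using assms by simp
  also have "\<dots> \<le> n * b" using assms by (intro mult_right_mono) auto
  finally show ?thesis by (simp add: mult.commute)
qed

text \<open>
  Division with remainder replaced by coordinates: \<open>a\<close> is the block position and \<open>r\<close> the component
  within its kind, which makes both \<open>i\<close> and its image explicit sums free of \<open>div\<close> and \<open>mod\<close>.
\<close>

lemma regroup_indices_cases:
  assumes k: "k > 0" and q: "q > 0" and i: "i < (k + q) * n"
  obtains (first) a r where "i = a * k + r" "r < k" "a < n" "i < k * n"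
      "regroup_indices k q n i = a * (k + q) + r"
  | (second) a r where "i = k * n + a * q + r" "r < q" "a < n" "\<not> i < k * n"
      "regroup_indices k q n i = a * (k + q) + (k + r)"
proof (cases "i < k * n")
  case True
  then show ?thesis
    using k by (intro first[of "i div k" "i mod k"])
      (auto simp: regroup_indices_def less_mult_imp_div_less mult.commute)
next
  case False
  then have "i - k * n < n * q" using i by (simp add: algebra_simps)
  then show ?thesis
    using q i False by (intro second[of "(i - k * n) div q" "(i - k * n) mod q"])
      (auto simp: regroup_indices_def less_mult_imp_div_less)
qed

lemma regroup_indices_permutes:
  assumes k: "k > 0" and q: "q > 0"
  shows "regroup_indices k q n permutes {..<(k + q) * n}"
proof (rule bij_imp_permutes)
  let ?p = "regroup_indices k q n" and ?I = "{..<(k + q) * n}"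
  have "?p ` ?I \<subseteq> ?I"
  proof (rule image_subsetI)
    fix i assume "i \<in> ?I"
    then have "i < (k + q) * n" by simp
    with k q show "?p i \<in> ?I"
      by (cases rule: regroup_indices_cases) (simp_all add: add_mult_less_mult)
  qed
  moreover have "inj_on ?p ?I"
  proof (rule inj_onI)
    fix i l assume "i \<in> ?I" "l \<in> ?I" and eq: "?p i = ?p l"
    then have i: "i < (k + q) * n" and l: "l < (k + q) * n" by simp_all
    \<comment> \<open>An image determines block position and component, by uniqueness of division by \<open>k + q\<close>;
      components of the second kind are the ones from \<open>k\<close> on.\<close>
    have *: "a = b \<and> r = s"
      if "a * (k + q) + r = b * (k + q) + s" "r < k + q" "s < k + q" for a b r s
      using that by (metis div_mult_self3 mod_mult_self3 div_less mod_less add_0_right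
          gr_implies_not0)
    from k q i show "i = l"
    proof (cases rule: regroup_indices_cases)
      case (first a r)
      note i1 = this
      from k q l show ?thesis
      proof (cases rule: regroup_indices_cases)
        case (first b s)
        then show ?thesis using i1 eq *[of a r b s] by simp
      next
        case (second b s)
        then show ?thesis using i1 eq *[of a r b "k + s"] by simp
      qed
    next
      case (second a r)
      note i2 = this
      from k q l show ?thesis
      proof (cases rule: regroup_indices_cases)
        case (first b s)
        then show ?thesis using i2 eq *[of a "k + r" b s] by simp
      next
        case (second b s)
        then show ?thesis using i2 eq *[of a "k + r" b "k + s"] by simp
      qed
    qed
  qed
  ultimately show "bij_betw ?p ?I ?I"
    by (simp add: bij_betw_def endo_inj_surj)
next
  fix i assume "i \<notin> {..<(k + q) * n}"
  then show "regroup_indices k q n i = i"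
    by (simp add: regroup_indices_def algebra_simps)
qed

section \<open>Fourier coefficients and Toeplitz matrices of block functions\<close>

lemma dim_fourier_coeff [simp]:
  "dim_row (fourier_coeff a b \<phi> j) = a" "dim_col (fourier_coeff a b \<phi> j) = b"
  by (simp_all add: fourier_coeff_def)

lemma dim_block_toeplitz [simp]:
  "dim_row (block_toeplitz a b n \<phi>) = a * n" "dim_col (block_toeplitz a b n \<phi>) = b * n"
  by (simp_all add: block_toeplitz_def)

text \<open>
  The blocks of a value of the integrand are located by the dimensions of its upper left block, so the
  position of the block borders must be constant where the integral looks, that is on \<open>{-pi..pi}\<close>. Given
  this, the entry of the assembled function is one fixed entry of one of the four functions there.
\<close>

lemma fourier_coeff_four_block_mat:
  assumes "\<And>\<theta>. \<theta> \<in> {-pi..pi} \<Longrightarrow> g11 \<theta> \<in> carrier_mat a b"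
    and "\<And>\<theta>. \<theta> \<in> {-pi..pi} \<Longrightarrow> g12 \<theta> \<in> carrier_mat a d"
    and "\<And>\<theta>. \<theta> \<in> {-pi..pi} \<Longrightarrow> g21 \<theta> \<in> carrier_mat c b"
    and "\<And>\<theta>. \<theta> \<in> {-pi..pi} \<Longrightarrow> g22 \<theta> \<in> carrier_mat c d"
  shows "fourier_coeff (a + c) (b + d) (\<lambda>\<theta>. four_block_mat (g11 \<theta>) (g12 \<theta>) (g21 \<theta>) (g22 \<theta>)) j =
    four_block_mat (fourier_coeff a b g11 j) (fourier_coeff a d g12 j)
      (fourier_coeff c b g21 j) (fourier_coeff c d g22 j)"
    (is "fourier_coeff _ _ ?g j = ?F")
proof (rule eq_matI)
  fix r s assume "r < dim_row ?F" "s < dim_col ?F"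
  then have rs: "r < a + c" "s < b + d" by simp_all
  have block: "?g \<theta> $$ (r, s) =
      (if r < a then if s < b then g11 \<theta> $$ (r, s) else g12 \<theta> $$ (r, s - b)
       else if s < b then g21 \<theta> $$ (r - a, s) else g22 \<theta> $$ (r - a, s - b))"
    if "\<theta> \<in> {-pi..pi}" for \<theta>
    using assms[OF that] rs by (subst index_mat_four_block) auto
  have "fourier_coeff (a + c) (b + d) ?g j $$ (r, s) = 1 / (2 * of_real pi) *
      (LINT \<theta>:{-pi..pi}|lebesgue.
        (if r < a then if s < b then g11 \<theta> $$ (r, s) else g12 \<theta> $$ (r, s - b)
         else if s < b then g21 \<theta> $$ (r - a, s) else g22 \<theta> $$ (r - a, s - b)) *
        exp (- (\<i> * of_int j * of_real \<theta>)))"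
    using rs block by (auto simp: fourier_coeff_def intro!: set_lebesgue_integral_cong)
  also have "\<dots> = ?F $$ (r, s)"
    using rs by (auto simp: fourier_coeff_def)
  finally show "fourier_coeff (a + c) (b + d) ?g j $$ (r, s) = ?F $$ (r, s)" .
qed simp_all

lemma block_toeplitz_index:
  assumes "x < n" "y < n" "r < a" "s < b"
  shows "block_toeplitz a b n \<phi> $$ (x * a + r, y * b + s) =
    fourier_coeff a b \<phi> (int x - int y) $$ (r, s)"
  using assms add_mult_less_mult[of r a x n] add_mult_less_mult[of s b y n]
  by (simp add: block_toeplitz_def)

text \<open>
  If \<open>i\<close> and \<open>l\<close> have block positions \<open>x\<close> and \<open>y\<close>, both sides are the same entry of the Fourier
  coefficient with index \<open>x - y\<close> of one of the four functions: regrouping keeps the block position, and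
  the shift by \<open>k\<close> in components of the second kind selects the block.
\<close>

lemma block_toeplitz_four_block_index:
  assumes k: "k > 0" and q: "q > 0"
    and dims: "\<And>\<theta>. \<theta> \<in> {-pi..pi} \<Longrightarrow> g11 \<theta> \<in> carrier_mat k k"
      "\<And>\<theta>. \<theta> \<in> {-pi..pi} \<Longrightarrow> g12 \<theta> \<in> carrier_mat k q"
      "\<And>\<theta>. \<theta> \<in> {-pi..pi} \<Longrightarrow> g21 \<theta> \<in> carrier_mat q k"
      "\<And>\<theta>. \<theta> \<in> {-pi..pi} \<Longrightarrow> g22 \<theta> \<in> carrier_mat q q"
    and i: "i < (k + q) * n" and l: "l < (k + q) * n"
  shows "four_block_mat
           (block_toeplitz k k n g11) (block_toeplitz k q n g12)
           (block_toeplitz q k n g21) (block_toeplitz q q n g22) $$ (i, l) =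
    block_toeplitz (k + q) (k + q) n (\<lambda>\<theta>. four_block_mat (g11 \<theta>) (g12 \<theta>) (g21 \<theta>) (g22 \<theta>))
      $$ (regroup_indices k q n i, regroup_indices k q n l)"
    (is "?A $$ _ = ?T $$ _")
proof -
  have A_index: "?A $$ (i, l) =
      (if i < k * n
       then if l < k * n then block_toeplitz k k n g11 $$ (i, l)
            else block_toeplitz k q n g12 $$ (i, l - k * n)
       else if l < k * n then block_toeplitz q k n g21 $$ (i - k * n, l)
            else block_toeplitz q q n g22 $$ (i - k * n, l - k * n))"
    using i l by (subst index_mat_four_block) (auto simp: algebra_simps)
  have coeff: "fourier_coeff (k + q) (k + q)
      (\<lambda>\<theta>. four_block_mat (g11 \<theta>) (g12 \<theta>) (g21 \<theta>) (g22 \<theta>)) j =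
    four_block_mat (fourier_coeff k k g11 j) (fourier_coeff k q g12 j)
      (fourier_coeff q k g21 j) (fourier_coeff q q g22 j)" for j
    using dims by (rule fourier_coeff_four_block_mat)
  have T_index: "?T $$ (x * (k + q) + r, y * (k + q) + s) =
      four_block_mat (fourier_coeff k k g11 (int x - int y)) (fourier_coeff k q g12 (int x - int y))
        (fourier_coeff q k g21 (int x - int y)) (fourier_coeff q q g22 (int x - int y)) $$ (r, s)"
    if "x < n" "y < n" "r < k + q" "s < k + q" for x y r s
    using that by (simp only: block_toeplitz_index coeff)
  from k q i show ?thesis
  proof (cases rule: regroup_indices_cases)
    case i_cases: (first x r)
    from k q l show ?thesis
    proof (cases rule: regroup_indices_cases)
      case l_cases: (first y s)
      have "?A $$ (i, l) = block_toeplitz k k n g11 $$ (x * k + r, y * k + s)"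
        unfolding A_index using i_cases(1,4) l_cases(1,4) by auto
      also have "\<dots> = fourier_coeff k k g11 (int x - int y) $$ (r, s)"
        by (rule block_toeplitz_index[OF i_cases(3) l_cases(3) i_cases(2) l_cases(2)])
      also have "\<dots> = ?T $$ (x * (k + q) + r, y * (k + q) + s)"
        using i_cases(2,3) l_cases(2,3) by (simp add: T_index)
      finally show ?thesis
        by (simp only: i_cases(5) l_cases(5))
    next
      case l_cases: (second y s)
      have "?A $$ (i, l) = block_toeplitz k q n g12 $$ (x * k + r, y * q + s)"
        unfolding A_index using i_cases(1,4) l_cases(1,4) by auto
      also have "\<dots> = fourier_coeff k q g12 (int x - int y) $$ (r, s)"
        by (rule block_toeplitz_index[OF i_cases(3) l_cases(3) i_cases(2) l_cases(2)])
      also have "\<dots> = ?T $$ (x * (k + q) + r, y * (k + q) + (k + s))"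
        using i_cases(2,3) l_cases(2,3) by (simp add: T_index)
      finally show ?thesis
        by (simp only: i_cases(5) l_cases(5))
    qed
  next
    case i_cases: (second x r)
    from k q l show ?thesis
    proof (cases rule: regroup_indices_cases)
      case l_cases: (first y s)
      have "?A $$ (i, l) = block_toeplitz q k n g21 $$ (x * q + r, y * k + s)"
        unfolding A_index using i_cases(1,4) l_cases(1,4) by auto
      also have "\<dots> = fourier_coeff q k g21 (int x - int y) $$ (r, s)"
        by (rule block_toeplitz_index[OF i_cases(3) l_cases(3) i_cases(2) l_cases(2)])
      also have "\<dots> = ?T $$ (x * (k + q) + (k + r), y * (k + q) + s)"
        using i_cases(2,3) l_cases(2,3) by (simp add: T_index)
      finally show ?thesis
        by (simp only: i_cases(5) l_cases(5))
    next
      case l_cases: (second y s)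
      have "?A $$ (i, l) = block_toeplitz q q n g22 $$ (x * q + r, y * q + s)"
        unfolding A_index using i_cases(1,4) l_cases(1,4) by auto
      also have "\<dots> = fourier_coeff q q g22 (int x - int y) $$ (r, s)"
        by (rule block_toeplitz_index[OF i_cases(3) l_cases(3) i_cases(2) l_cases(2)])
      also have "\<dots> = ?T $$ (x * (k + q) + (k + r), y * (k + q) + (k + s))"
        using i_cases(2,3) l_cases(2,3) by (simp add: T_index)
      finally show ?thesis
        by (simp only: i_cases(5) l_cases(5))
    qed
  qed
qed

section \<open>Eigenvalue and singular value distributions\<close>

theorem theorem17:
  fixes k q :: nat
    and f11 f12 f21 f22 f :: "real \<Rightarrow> complex mat"
    and A T :: "nat \<Rightarrow> complex mat"
  assumes "k > 0" and "q > 0"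
    and "L1_matrix_fun k k f11"
    and "L1_matrix_fun k q f12"
    and "L1_matrix_fun q k f21"
    and "L1_matrix_fun q q f22"
  defines "f \<equiv> \<lambda>\<theta>. four_block_mat (f11 \<theta>) (f12 \<theta>) (f21 \<theta>) (f22 \<theta>)"
    and "A \<equiv> \<lambda>n. four_block_mat
           (block_toeplitz k k n f11) (block_toeplitz k q n f12)
           (block_toeplitz q k n f21) (block_toeplitz q q n f22)"
    and "T \<equiv> \<lambda>n. block_toeplitz (k + q) (k + q) n f"
  shows "(\<forall>n>0. \<exists>P. permutation_matrix ((k + q) * n) P \<and> A n = P * T n * transpose_mat P)
    \<and> (\<forall>n>0. eigenvalues (A n) = eigenvalues (T n))
    \<and> (\<forall>n>0. singular_values (A n) = singular_values (T n))
    \<and> (\<forall>r \<alpha> \<beta> \<phi>. r > 0 \<longrightarrow> \<alpha> < \<beta> \<longrightarrow> measurable_matrix_fun r \<alpha> \<beta> \<phi> \<longrightarrow>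
          (eigenvalue_distributed A r \<phi> \<alpha> \<beta> \<longleftrightarrow> eigenvalue_distributed T r \<phi> \<alpha> \<beta>) \<and>
          (singular_value_distributed A r \<phi> \<alpha> \<beta> \<longleftrightarrow> singular_value_distributed T r \<phi> \<alpha> \<beta>))"
proof -
  note k = assms(1) and q = assms(2)
  let ?N = "\<lambda>n. (k + q) * n" and ?p = "regroup_indices k q"
  have dims: "f11 \<theta> \<in> carrier_mat k k" "f12 \<theta> \<in> carrier_mat k q"
      "f21 \<theta> \<in> carrier_mat q k" "f22 \<theta> \<in> carrier_mat q q" if "\<theta> \<in> {-pi..pi}" for \<theta>
    using that assms(3-6) by (auto simp: L1_matrix_fun_def)
  have A: "A n \<in> carrier_mat (?N n) (?N n)" for n
    by (simp add: A_def block_toeplitz_def algebra_simps)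
  have T: "T n \<in> carrier_mat (?N n) (?N n)" for n
    by (simp add: T_def block_toeplitz_def)
  have p: "?p n permutes {..<?N n}" for n
    using regroup_indices_permutes[OF k q] .
  have entry: "A n $$ (i, l) = T n $$ (?p n i, ?p n l)" if "i < ?N n" "l < ?N n" for n i l
    unfolding A_def T_def f_def using that k q dims by (intro block_toeplitz_four_block_index)
  have eig: "eigenvalues (A n) = eigenvalues (T n)" for n
    using eigenvalues_reindexed[OF p A T entry] .
  have sing: "singular_values (A n) = singular_values (T n)" for n
    using singular_values_reindexed[OF p A T entry] .
  have "permutation_matrix (?N n) (reindex_matrix (?N n) (?p n))" for n
    using p by (auto simp: permutation_matrix_def reindex_matrix_def)
  then have similar: "\<exists>P. permutation_matrix (?N n) P \<and> A n = P * T n * transpose_mat P" for n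
    using reindexed_eq_conjugate[OF p A T entry] by blast
  have dim: "dim_row (A n) = dim_row (T n)" "square_mat (A n)" "square_mat (T n)" for n
    using A[of n] T[of n] by auto
  have distr: "distributed S A r \<phi> \<alpha> \<beta> \<longleftrightarrow> distributed S T r \<phi> \<alpha> \<beta>"
    if "\<And>n. S (A n) = S (T n)" for S :: "complex mat \<Rightarrow> 'a::topological_space multiset" and r \<phi> \<alpha> \<beta>
    unfolding distributed_def using that dim by simp
  show ?thesis
    using similar eig sing distr[of eigenvalues] distr[of singular_values]
    by (simp add: eigenvalue_distributed_def singular_value_distributed_def)
qed

end
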